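(* The wild integer semigroup $\mathcal{W}(\mathbb{Z})$ contains infinitely many irreducible elements; that is, there are infinitely many wild numbers.
   Context: For integers $n\ge 0$ let $g(n)=\frac{3n+2}{2n+1}$. The wild semigroup $\mathcal{W}$ is the multiplicative semigroup of positive rationals generated by $\{g(n): n\ge 0\}$ together with $\frac12$ (all finite products of these, repetitions allowed; it contains $1=g(0)\cdot\frac12$). The wild integer semigroup is $\mathcal{W}(\mathbb{Z})=\mathcal{W}\cap\mathbb{Z}$, a commutative multiplicative semigroup with unit $1$. An irreducible element of a commutative semigroup is one that cannot be written as a product of two nonunits (noninvertible elements) of the semigroup. The wild numbers are the irreducible elements of $\mathcal{W}(\mathbb{Z})$. *)

theory Defs
  imports Complex_Main
begin

definition wild_gen :: "nat \<Rightarrow> rat" where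
  "wild_gen n = (3 * of_nat n + 2) / (2 * of_nat n + 1)"

text \<open>Semigroup closure: only nonempty products are generated, so that membership of 1 is a
  consequence rather than part of the definition.\<close>

inductive_set wild_semigroup :: "rat set" where
  gen: "wild_gen n \<in> wild_semigroup"
| half: "1 / 2 \<in> wild_semigroup"
| mult: "\<lbrakk>x \<in> wild_semigroup; y \<in> wild_semigroup\<rbrakk> \<Longrightarrow> x * y \<in> wild_semigroup"

definition wild_integer_semigroup :: "rat set" where
  "wild_integer_semigroup = wild_semigroup \<inter> \<int>"

definition unit_in :: "'a::comm_monoid_mult set \<Rightarrow> 'a \<Rightarrow> bool" where
  "unit_in S u \<longleftrightarrow> u \<in> S \<and> (\<exists>v\<in>S. u * v = 1)"

text \<open>The set \<open>S\<close> is meant to be closed under multiplication and to contain 1. Units are not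
  excluded: they satisfy the definition vacuously. In the wild integer semigroup the
  only unit is 1, so this convention affects at most one element.\<close>

definition irreducible_in :: "'a::comm_monoid_mult set \<Rightarrow> 'a \<Rightarrow> bool" where
  "irreducible_in S a \<longleftrightarrow> a \<in> S \<and>
     \<not> (\<exists>b\<in>S. \<exists>c\<in>S. \<not> unit_in S b \<and> \<not> unit_in S c \<and> a = b * c)"

definition wild_numbers :: "rat set" where
  "wild_numbers = {a. irreducible_in wild_integer_semigroup a}"

lemma one_in_wild_integer_semigroup: "1 \<in> wild_integer_semigroup"
proof -
  have "wild_gen 0 * (1 / 2) \<in> wild_semigroup"
    by (intro wild_semigroup.intros)
  then show ?thesis
    by (simp add: wild_integer_semigroup_def wild_gen_def)
qed

lemma wild_semigroup_pos: "x \<in> wild_semigroup \<Longrightarrow> x > 0"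
  by (induction rule: wild_semigroup.induct) (auto simp: wild_gen_def intro!: divide_pos_pos add_nonneg_pos)

lemma unit_in_wild_integer_semigroup_iff: "unit_in wild_integer_semigroup u \<longleftrightarrow> u = 1"
proof
  assume "unit_in wild_integer_semigroup u"
  then obtain v where uv: "u \<in> wild_semigroup" "v \<in> wild_semigroup" "u \<in> \<int>" "v \<in> \<int>" "u * v = 1"
    by (auto simp: unit_in_def wild_integer_semigroup_def)
  obtain i j where ij: "u = of_int i" "v = of_int j"
    using uv(3,4) by (auto elim!: Ints_cases)
  have "i > 0" using wild_semigroup_pos[OF uv(1)] ij by simp
  moreover have "i * j = 1"
    using uv(5) unfolding ij of_int_mult[symmetric] by (simp only: of_int_eq_1_iff)
  ultimately show "u = 1" using ij by (simp add: pos_zmult_eq_1_iff)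
next
  assume "u = 1"
  then show "unit_in wild_integer_semigroup u"
    using one_in_wild_integer_semigroup by (auto simp: unit_in_def)
qed

end

theory Submission
  imports Defs "HOL-Computational_Algebra.Primes"
begin

text \<open>Since \<open>wild_gen n = (3m + 1) / (2m)\<close> for \<open>m = 2n + 1\<close>, an odd \<open>m\<close> in \<open>\<W>(\<int>)\<close> yields
  \<open>(3m + 1) / 2\<close> in \<open>\<W>(\<int>)\<close>, which is coprime to \<open>m\<close>, and factors of 2 can be stripped because
  \<open>1/2 \<in> \<W>\<close>. If there were only finitely many wild numbers, Euclid's argument would apply: let
  \<open>M\<close> be 5 times the product of their odd parts. Then \<open>(3M\<^sup>2 + 1) / 4\<close> lies in \<open>\<W>(\<int>)\<close>, is odd
  (as \<open>M\<^sup>2 \<equiv> 1 (mod 8)\<close>), greater than 1 and coprime to \<open>M\<close>, yet it has an irreducible factor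
  other than 1, which is odd and therefore divides \<open>M\<close>.\<close>

text \<open>Parity, divisibility and coprimality are meaningful over \<open>nat\<close>, whereas
  divisibility in the field \<open>rat\<close> is trivial.\<close>

definition wild_nats :: "nat set" where
  "wild_nats = {m. of_nat m \<in> wild_semigroup}"

lemma wild_integer_semigroup_eq_image: "wild_integer_semigroup = of_nat ` wild_nats"
proof (intro set_eqI iffI)
  fix x assume x: "x \<in> wild_integer_semigroup"
  then obtain i where i: "x = of_int i"
    by (auto simp: wild_integer_semigroup_def elim: Ints_cases)
  have "x > 0" using x wild_semigroup_pos by (simp add: wild_integer_semigroup_def)
  then have "x = of_nat (nat i)" using i by simp
  then show "x \<in> of_nat ` wild_nats"
    using x by (auto simp: wild_nats_def wild_integer_semigroup_def)
qed (auto simp: wild_nats_def wild_integer_semigroup_def)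

lemma wild_nats_pos: "m \<in> wild_nats \<Longrightarrow> m > 0"
  using wild_semigroup_pos[of "of_nat m"] by (simp add: wild_nats_def)

lemma one_in_wild_semigroup: "1 \<in> wild_semigroup"
  using one_in_wild_integer_semigroup by (simp add: wild_integer_semigroup_def)

lemma one_in_wild_nats: "1 \<in> wild_nats"
  by (simp add: wild_nats_def one_in_wild_semigroup)

lemma mult_in_wild_nats: "a \<in> wild_nats \<Longrightarrow> b \<in> wild_nats \<Longrightarrow> a * b \<in> wild_nats"
  by (simp add: wild_nats_def wild_semigroup.mult)

lemma prod_in_wild_nats:
  "(\<And>x. x \<in> A \<Longrightarrow> f x \<in> wild_nats) \<Longrightarrow> prod f A \<in> wild_nats"
  \<comment> \<open>The product over an infinite set is 1 by convention, so \<open>A\<close> may be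
    arbitrary.\<close>
  by (induction A rule: infinite_finite_induct)
    (simp_all add: mult_in_wild_nats one_in_wild_nats[unfolded One_nat_def])

lemma power_in_wild_semigroup: "x \<in> wild_semigroup \<Longrightarrow> x ^ n \<in> wild_semigroup"
  by (induction n) (simp_all add: one_in_wild_semigroup wild_semigroup.mult)

lemma half_in_wild_nats:
  assumes "2 * m \<in> wild_nats"
  shows "m \<in> wild_nats"
  using wild_semigroup.mult[OF wild_semigroup.half, of "of_nat (2 * m)"] assms
  by (simp add: wild_nats_def)

text \<open>The denominator of \<open>wild_gen n\<close> cancels. For m = 2n + 1 the result is the
  accelerated Collatz step (3m + 1) / 2.\<close>

lemma collatz_step_in_wild_nats:
  assumes "2 * n + 1 \<in> wild_nats"
  shows "3 * n + 2 \<in> wild_nats"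
proof -
  have "wild_gen n * of_nat (2 * n + 1) \<in> wild_semigroup"
    using assms by (intro wild_semigroup.intros) (simp add: wild_nats_def)
  moreover have "wild_gen n * of_nat (2 * n + 1) = of_nat (3 * n + 2)"
  proof -
    have "(2 * of_nat n + 1 :: rat) \<noteq> 0"
      using of_nat_0_le_iff[of n, where 'a = rat] by linarith
    then show ?thesis by (simp add: wild_gen_def add.commute)
  qed
  ultimately show ?thesis by (simp only: wild_nats_def mem_Collect_eq)
qed

text \<open>The factorisation was found by an integer programming search over the generators whose
  numerator and denominator only involve the primes 2, 5, 7, 11, 13 and 17.\<close>

lemma five_in_wild_nats: "5 \<in> wild_nats"
proof -
  have "wild_gen 3 ^ 4 * wild_gen 5 ^ 4 * wild_gen 8 ^ 3 * wild_gen 32 ^ 3 * wild_gen 416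
      * (1 / 2) ^ 7 \<in> wild_semigroup"
    by (intro wild_semigroup.mult power_in_wild_semigroup wild_semigroup.gen wild_semigroup.half)
  then show ?thesis
    by (simp add: wild_nats_def wild_gen_def field_simps)
qed

definition odd_part :: "nat \<Rightarrow> nat" where
  "odd_part m = m div 2 ^ multiplicity 2 m"

lemma two_power_times_odd_part: "2 ^ multiplicity 2 m * odd_part m = m"
  by (simp add: odd_part_def multiplicity_dvd)

lemma odd_odd_part: "m > 0 \<Longrightarrow> odd (odd_part m)"
  unfolding odd_part_def using multiplicity_decompose[of m 2] by simp

lemma odd_part_in_wild_nats:
  assumes "m \<in> wild_nats"
  shows "odd_part m \<in> wild_nats"
proof -
  have "2 ^ k * b \<in> wild_nats \<Longrightarrow> b \<in> wild_nats" for k b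
    by (induction k) (auto simp: mult.assoc dest: half_in_wild_nats)
  from this[of "multiplicity 2 m"] show ?thesis
    using assms by (simp add: two_power_times_odd_part)
qed

lemma dvd_odd_part_if_odd: "odd m \<Longrightarrow> m dvd odd_part m"
  using two_power_times_odd_part[of m] by (simp add: not_dvd_imp_multiplicity_0)

text \<open>Since 1 is the only unit, a reducible \<open>m\<close> has a proper factor greater than
  1 in \<open>wild_nats\<close>, and induction applies to it. The bound \<open>q > 1\<close> matters
  because 1 itself belongs to \<open>wild_numbers\<close>.\<close>

lemma wild_nat_has_irreducible_divisor:
  assumes "m \<in> wild_nats" "m > 1"
  shows "\<exists>q. q > 1 \<and> q dvd m \<and> of_nat q \<in> wild_numbers"
  using assms
proof (induction m rule: less_induct)
  case (less m)
  show ?case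
  proof (cases "of_nat m \<in> wild_numbers")
    case True
    then show ?thesis using less.prems by (intro exI[of _ m]) simp
  next
    case False
    moreover have "of_nat m \<in> wild_integer_semigroup"
      using less.prems by (simp add: wild_integer_semigroup_eq_image)
    ultimately obtain x y where xy: "x \<in> wild_integer_semigroup" "y \<in> wild_integer_semigroup"
      "x \<noteq> 1" "y \<noteq> 1" "of_nat m = x * y"
      unfolding wild_numbers_def irreducible_in_def unit_in_wild_integer_semigroup_iff by blast
    obtain b c where bc: "b \<in> wild_nats" "c \<in> wild_nats" "x = of_nat b" "y = of_nat c"
      using xy(1,2) unfolding wild_integer_semigroup_eq_image by blast
    have m: "m = b * c"
      using xy(5) unfolding bc of_nat_mult[symmetric] of_nat_eq_iff .
    have "b \<noteq> 1" "c \<noteq> 1" using xy(3,4) bc(3,4) by auto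
    then have "b > 1" "c > 1"
      using wild_nats_pos[OF bc(1)] wild_nats_pos[OF bc(2)] by auto
    then have "b < m" using m by simp
    then obtain q where "q > 1" "q dvd b" "of_nat q \<in> wild_numbers"
      using less.IH[OF _ bc(1) \<open>b > 1\<close>] by auto
    then show ?thesis using m by (intro exI[of _ q]) simp
  qed
qed

lemma coprime_odd_wild_nat:
  assumes "M \<in> wild_nats" "odd M" "M > 1"
  obtains N where "N \<in> wild_nats" "odd N" "N > 1" "coprime N M"
proof -
  obtain t where t: "M = 2 * t + 1" using assms(2) by (elim oddE)
  have "even (t * (t + 1))" by simp
  then obtain r where r: "t * (t + 1) = 2 * r" by (elim evenE)
  have sq: "M * M = 8 * r + 1"
    using r unfolding t by (simp add: algebra_simps)
  \<comment> \<open>The Collatz step sends M * M = 8r + 1 to 12r + 2 = 2N. Squaring ensures that a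
    single halving reaches an odd number.\<close>
  define N where "N = 6 * r + 1"
  have "2 * (4 * r) + 1 \<in> wild_nats"
    using mult_in_wild_nats[OF assms(1) assms(1)] sq by simp
  from collatz_step_in_wild_nats[OF this]
  have "2 * N \<in> wild_nats" by (simp add: N_def algebra_simps)
  then have "N \<in> wild_nats" by (rule half_in_wild_nats)
  moreover have "odd N" by (simp add: N_def)
  moreover have "N > 1" using assms(3) sq by (cases r) (auto simp: N_def)
  moreover have "coprime N M"
  proof (rule coprimeI)
    fix d assume d: "d dvd N" "d dvd M"
    have "4 * N = 3 * (M * M) + 1" by (simp add: sq N_def)
    then have "d dvd 3 * (M * M) + 1" using dvd_mult[OF d(1), of 4] by simp
    moreover have "d dvd 3 * (M * M)" using d(2) by simp
    ultimately show "d dvd 1" by (simp only: dvd_add_right_iff)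
  qed
  ultimately show ?thesis by (rule that)
qed

theorem theorem3p1:
  shows "infinite wild_numbers"
proof
  assume fin: "finite wild_numbers"
  define Q :: "nat set" where "Q = {q. of_nat q \<in> wild_numbers}"
  have finQ: "finite Q"
    unfolding Q_def using finite_vimageI[OF fin, of of_nat] by (simp add: vimage_def inj_on_def)
  have Q_wild: "q \<in> wild_nats" if "q \<in> Q" for q
    using that
    by (auto simp: Q_def wild_numbers_def irreducible_in_def wild_integer_semigroup_eq_image)
  \<comment> \<open>The factor 5 keeps \<open>M > 1\<close> even if every odd part is 1; from M = 1
    the construction would only return N = 1.\<close>
  define M where "M = 5 * (\<Prod>q\<in>Q. odd_part q)"
  have M_wild: "M \<in> wild_nats"
    unfolding M_def
    by (intro mult_in_wild_nats five_in_wild_nats prod_in_wild_nats odd_part_in_wild_nats Q_wild)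
  have "odd (\<Prod>q\<in>Q. odd_part q)"
    using finQ Q_wild by (auto simp: even_prod_iff odd_odd_part wild_nats_pos)
  then have "odd M" by (simp add: M_def)
  moreover have "M > 1" using wild_nats_pos[OF M_wild] by (simp add: M_def)
  ultimately obtain N where N: "N \<in> wild_nats" "odd N" "N > 1" "coprime N M"
    using M_wild coprime_odd_wild_nat by blast
  obtain q where q: "q > 1" "q dvd N" "q \<in> Q"
    using wild_nat_has_irreducible_divisor[OF N(1,3)] by (auto simp: Q_def)
  \<comment> \<open>An odd \<open>q\<close> loses nothing when replaced by its odd part, so it still
    divides \<open>M\<close>.\<close>
  have "odd q" using N(2) q(2) dvd_trans by blast
  then have "q dvd odd_part q" by (rule dvd_odd_part_if_odd)
  also have "\<dots> dvd (\<Prod>q\<in>Q. odd_part q)" using finQ q(3) by (rule dvd_prodI)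
  also have "\<dots> dvd M" by (simp add: M_def)
  finally have "q dvd 1" using N(4) q(2) coprime_common_divisor by blast
  then show False using q(1) by simp
qed

end
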